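(* Let $\mathscr{A}\subset\mathscr{X}$ be a convex acceptance set and $S=(S_0,S_T)$ a traded asset. If $\rho_{\mathscr{A},S}$ is finitely valued, then it is locally Lipschitz continuous. Moreover, if $\mathscr{A}$ is coherent and $\rho_{\mathscr{A},S}$ is finitely valued, then $\rho_{\mathscr{A},S}$ is globally Lipschitz continuous.
   Context: Let $(\Omega,\mathcal{F})$ be a measurable space and $\mathscr{X}$ the Banach space of bounded $\mathcal{F}$-measurable functions $X:\Omega\to\mathbb{R}$ with the supremum norm $\|X\|=\sup_{\omega\in\Omega}|X(\omega)|$, ordered pointwise; $\mathscr{X}_+=\{X\in\mathscr{X}: X\ge 0\}$. Functions are not identified almost surely. Lipschitz continuity is with respect to this norm. An acceptance set is a nonempty proper subset $\mathscr{A}\subset\mathscr{X}$ such that $X\in\mathscr{A}$ and $Y\ge X$ imply $Y\in\mathscr{A}$. It is coherent if it is a convex cone, where a cone is a set closed under multiplication by scalars $\lambda>0$. A traded asset is a pair $S=(S_0,S_T)$ with $S_0\in\mathbb{R}$, $S_0>0$, and $S_T\in\mathscr{X}_+$, $S_T\ne 0$. The risk measure is $\rho_{\mathscr{A},S}:\mathscr{X}\to\mathbb{R}\cup\{-\infty,\infty\}$, $\rho_{\mathscr{A},S}(X)=\inf\{m\in\mathbb{R}: X+\frac{m}{S_0}S_T\in\mathscr{A}\}$ (with $\inf\emptyset=\infty$). It is finitely valued if $\rho_{\mathscr{A},S}(X)\in\mathbb{R}$ for every $X\in\mathscr{X}$. *)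

theory Defs
  imports "HOL-Analysis.Analysis" "HOL-Library.Function_Algebras"
begin

instantiation "fun" :: (type, real_vector) real_vector
begin

definition scaleR_fun :: "real \<Rightarrow> ('a \<Rightarrow> 'b) \<Rightarrow> 'a \<Rightarrow> 'b"
  where "scaleR_fun c f = (\<lambda>x. c *\<^sub>R f x)"

instance
  by standard (auto simp: scaleR_fun_def fun_eq_iff algebra_simps)

end

lemma scaleR_fun_apply [simp]: "(c *\<^sub>R f) x = c *\<^sub>R f x"
  by (simp add: scaleR_fun_def)

(* The measurable space is (space M, sets M); the measure of M plays no role.  A function on
   space M is represented by its extension by zero, which is unique, so that equality, order and
   vector space operations on functions 'a \<Rightarrow> real are the pointwise ones on space M. *)
definition bounded_measurable :: "'a measure \<Rightarrow> ('a \<Rightarrow> real) set"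
  where "bounded_measurable M =
    {X \<in> borel_measurable M. bounded (X ` space M) \<and> (\<forall>\<omega>. \<omega> \<notin> space M \<longrightarrow> X \<omega> = 0)}"

(* Sup {} is unspecified on the reals, hence the separate clause for an empty sample space. *)
definition sup_norm :: "'a measure \<Rightarrow> ('a \<Rightarrow> real) \<Rightarrow> real"
  where "sup_norm M X = (if space M = {} then 0 else SUP \<omega>\<in>space M. \<bar>X \<omega>\<bar>)"

(* The locale Metric_space wants a distance that is symmetric and nonnegative also off the
   carrier, hence the cutoff. *)
definition sup_dist :: "'a measure \<Rightarrow> ('a \<Rightarrow> real) \<Rightarrow> ('a \<Rightarrow> real) \<Rightarrow> real"
  where "sup_dist M X Y =
    (if X \<in> bounded_measurable M \<and> Y \<in> bounded_measurable M then sup_norm M (X - Y) else 0)"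

definition sup_metric :: "'a measure \<Rightarrow> ('a \<Rightarrow> real) metric"
  where "sup_metric M = metric (bounded_measurable M, sup_dist M)"

lemma subspace_bounded_measurable: "subspace (bounded_measurable M)"
proof (rule subspaceI)
  show "0 \<in> bounded_measurable M"
    by (auto simp: bounded_measurable_def zero_fun_def intro!: boundedI[where B = 0])
next
  fix X Y assume "X \<in> bounded_measurable M" "Y \<in> bounded_measurable M"
  then show "X + Y \<in> bounded_measurable M"
    by (auto simp: bounded_measurable_def plus_fun_def intro: bounded_plus_comp)
next
  fix c and X assume "X \<in> bounded_measurable M"
  then show "c *\<^sub>R X \<in> bounded_measurable M"
    by (auto simp: bounded_measurable_def scaleR_fun_def
        dest: bounded_scaleR_comp[where r = c])
qed

lemma sup_norm_upper:
  assumes "X \<in> bounded_measurable M" "\<omega> \<in> space M"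
  shows "\<bar>X \<omega>\<bar> \<le> sup_norm M X"
proof -
  have "bdd_above ((\<lambda>\<omega>. \<bar>X \<omega>\<bar>) ` space M)"
    using assms(1) by (auto simp: bounded_measurable_def bounded_iff bdd_above_def)
  then show ?thesis
    using assms(2) by (auto simp: sup_norm_def intro: cSUP_upper)
qed

lemma sup_norm_least:
  assumes "\<And>\<omega>. \<omega> \<in> space M \<Longrightarrow> \<bar>X \<omega>\<bar> \<le> c" "0 \<le> c"
  shows "sup_norm M X \<le> c"
  using assms by (auto simp: sup_norm_def intro: cSUP_least)

lemma sup_norm_nonneg:
  assumes "X \<in> bounded_measurable M"
  shows "0 \<le> sup_norm M X"
proof (cases "space M = {}")
  case False
  then obtain \<omega> where "\<omega> \<in> space M" by blast
  then show ?thesis using sup_norm_upper[OF assms] abs_ge_zero order_trans by blast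
qed (simp add: sup_norm_def)

lemma Metric_space_sup_dist: "Metric_space (bounded_measurable M) (sup_dist M)"
proof
  note diff = subspace_diff[OF subspace_bounded_measurable[of M]]
  show "0 \<le> sup_dist M X Y" for X Y
    by (auto simp: sup_dist_def intro: sup_norm_nonneg diff)
  show "sup_dist M X Y = sup_dist M Y X" for X Y
    by (simp add: sup_dist_def sup_norm_def abs_minus_commute)
  show "sup_dist M X Y = 0 \<longleftrightarrow> X = Y"
    if X: "X \<in> bounded_measurable M" and Y: "Y \<in> bounded_measurable M" for X Y
  proof
    assume "sup_dist M X Y = 0"
    then have "sup_norm M (X - Y) = 0" using X Y by (simp add: sup_dist_def)
    then have "X \<omega> = Y \<omega>" if "\<omega> \<in> space M" for \<omega>
      using sup_norm_upper[OF diff[OF X Y] that] by simp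
    moreover have "X \<omega> = Y \<omega>" if "\<omega> \<notin> space M" for \<omega>
      using X Y that by (simp add: bounded_measurable_def)
    ultimately show "X = Y" by blast
  qed (simp add: sup_dist_def sup_norm_def)
  show "sup_dist M X Z \<le> sup_dist M X Y + sup_dist M Y Z"
    if X: "X \<in> bounded_measurable M" and Y: "Y \<in> bounded_measurable M"
      and Z: "Z \<in> bounded_measurable M" for X Y Z
  proof -
    have "\<bar>(X - Z) \<omega>\<bar> \<le> sup_norm M (X - Y) + sup_norm M (Y - Z)" if "\<omega> \<in> space M" for \<omega>
      using sup_norm_upper[OF diff[OF X Y] that] sup_norm_upper[OF diff[OF Y Z] that] by simp
    then have "sup_norm M (X - Z) \<le> sup_norm M (X - Y) + sup_norm M (Y - Z)"
      by (intro sup_norm_least) (auto intro: add_nonneg_nonneg sup_norm_nonneg diff X Y Z)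
    then show ?thesis using X Y Z by (simp add: sup_dist_def)
  qed
qed

lemma mspace_sup_metric [simp]: "mspace (sup_metric M) = bounded_measurable M"
  and mdist_sup_metric [simp]: "mdist (sup_metric M) = sup_dist M"
  by (simp_all add: sup_metric_def Metric_space.mspace_metric Metric_space.mdist_metric
      Metric_space_sup_dist)

definition acceptance_set :: "'a measure \<Rightarrow> ('a \<Rightarrow> real) set \<Rightarrow> bool"
  where "acceptance_set M A \<longleftrightarrow> A \<noteq> {} \<and> A \<subset> bounded_measurable M \<and>
    (\<forall>X\<in>A. \<forall>Y\<in>bounded_measurable M. X \<le> Y \<longrightarrow> Y \<in> A)"

(* The library constants cone and conic also allow the scalar 0. *)
definition positive_cone :: "'b::real_vector set \<Rightarrow> bool"
  where "positive_cone A \<longleftrightarrow> (\<forall>X\<in>A. \<forall>c>0. c *\<^sub>R X \<in> A)"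

definition coherent :: "('a \<Rightarrow> real) set \<Rightarrow> bool"
  where "coherent A \<longleftrightarrow> convex A \<and> positive_cone A"

definition traded_asset :: "'a measure \<Rightarrow> real \<times> ('a \<Rightarrow> real) \<Rightarrow> bool"
  where "traded_asset M S \<longleftrightarrow>
    fst S > 0 \<and> snd S \<in> bounded_measurable M \<and> 0 \<le> snd S \<and> snd S \<noteq> 0"

definition risk_measure :: "('a \<Rightarrow> real) set \<Rightarrow> real \<times> ('a \<Rightarrow> real) \<Rightarrow> ('a \<Rightarrow> real) \<Rightarrow> ereal"
  where "risk_measure A S X = Inf {ereal m | m. X + (m / fst S) *\<^sub>R snd S \<in> A}"

definition finitely_valued :: "'a measure \<Rightarrow> (('a \<Rightarrow> real) \<Rightarrow> ereal) \<Rightarrow> bool"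
  where "finitely_valued M \<rho> \<longleftrightarrow> (\<forall>X\<in>bounded_measurable M. \<exists>r. \<rho> X = ereal r)"

(* Lipschitz continuity is a property of real-valued maps.  As real_of_ereal sends both
   infinities to 0, the next two definitions are meaningful for finitely valued maps only. *)
definition globally_Lipschitz :: "'a measure \<Rightarrow> (('a \<Rightarrow> real) \<Rightarrow> ereal) \<Rightarrow> bool"
  where "globally_Lipschitz M \<rho> \<longleftrightarrow>
    Lipschitz_continuous_map (sup_metric M) euclidean_metric (\<lambda>X. real_of_ereal (\<rho> X))"

definition locally_Lipschitz :: "'a measure \<Rightarrow> (('a \<Rightarrow> real) \<Rightarrow> ereal) \<Rightarrow> bool"
  where "locally_Lipschitz M \<rho> \<longleftrightarrow> (\<forall>X\<in>bounded_measurable M. \<exists>r>0.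
    Lipschitz_continuous_map (submetric (sup_metric M) (mball_of (sup_metric M) X r))
      euclidean_metric (\<lambda>Y. real_of_ereal (\<rho> Y)))"

end

theory Submission
  imports Defs
begin

text \<open>Monotonicity in the direction of the order unit \<open>u = indicator (space M)\<close> gives
  \<open>\<rho> Y \<le> \<rho> (X - d u)\<close> for \<open>d = \<parallel>X - Y\<parallel>\<close>.  If \<open>d \<le> 1\<close>, convexity along the segment from
  \<open>X\<close> to \<open>X - u\<close> bounds the increment \<open>\<rho> (X - d u) - \<rho> X\<close> by \<open>d (\<rho> (X - u) - \<rho> X)\<close>, and
  monotonicity bounds the slope uniformly on a ball.  If the acceptance set is coherent,
  \<open>\<rho>\<close> is sublinear and the increment is at most \<open>d \<rho> (- u)\<close> for all \<open>d\<close>.\<close>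

lemma indicator_space_bounded_measurable:
  "(indicator (space M) :: 'a \<Rightarrow> real) \<in> bounded_measurable M"
  by (auto simp: bounded_measurable_def bounded_iff indicator_def intro!: exI[of _ 1])

text \<open>Off \<open>space M\<close> all three functions vanish, so the bound by the norm on
  \<open>space M\<close> suffices. This turns distance into order, where monotonicity
  applies.\<close>

lemma le_add_sup_dist_indicator:
  assumes "X \<in> bounded_measurable M" "Y \<in> bounded_measurable M" "sup_dist M X Y \<le> d"
  shows "X \<le> Y + d *\<^sub>R indicator (space M)"
proof (rule le_funI)
  fix \<omega>
  have "X - Y \<in> bounded_measurable M"
    using assms subspace_diff subspace_bounded_measurable by blast
  then have "X \<omega> - Y \<omega> \<le> d" if "\<omega> \<in> space M"
    using sup_norm_upper[of "X - Y" M \<omega>] that assms by (simp add: sup_dist_def)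
  then show "X \<omega> \<le> (Y + d *\<^sub>R indicator (space M)) \<omega>"
    using assms by (cases "\<omega> \<in> space M") (fastforce simp: bounded_measurable_def)+
qed

locale finite_risk_measure =
  fixes M :: "'a measure" and A :: "('a \<Rightarrow> real) set" and S :: "real \<times> ('a \<Rightarrow> real)"
  assumes acceptance: "acceptance_set M A" and convex: "convex A" and asset: "traded_asset M S"
    and finite: "finitely_valued M (risk_measure A S)"
begin

definition \<rho> :: "('a \<Rightarrow> real) \<Rightarrow> real"
  where "\<rho> X = real_of_ereal (risk_measure A S X)"

abbreviation hedge :: "real \<Rightarrow> 'a \<Rightarrow> real"
  where "hedge m \<equiv> (m / fst S) *\<^sub>R snd S"

text \<open>The constant function 1, in the representation by functions that vanish off
  \<open>space M\<close>.\<close>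

abbreviation u :: "'a \<Rightarrow> real"
  where "u \<equiv> indicator (space M)"

lemmas subspace = subspace_bounded_measurable[of M]
lemmas closed_intros = subspace_add[OF subspace] subspace_diff[OF subspace]
  subspace_scale[OF subspace] indicator_space_bounded_measurable

lemma risk_measure_eq:
  assumes "X \<in> bounded_measurable M"
  shows "risk_measure A S X = ereal (\<rho> X)"
  using finite assms by (auto simp: finitely_valued_def \<rho>_def)

lemma acceptance_mono:
  assumes "X \<in> A" "X \<le> Y" "Y \<in> bounded_measurable M"
  shows "Y \<in> A"
  using acceptance assms by (auto simp: acceptance_set_def)

lemma hedge_closed: "hedge m \<in> bounded_measurable M"
  using asset by (intro closed_intros) (simp add: traded_asset_def)

lemma hedge_mono:
  assumes "m \<le> n"
  shows "hedge m \<le> hedge n"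
  using asset assms
  by (auto simp: traded_asset_def le_fun_def intro!: mult_right_mono divide_right_mono)

lemma \<rho>_lower:
  assumes "X \<in> bounded_measurable M" "X + hedge m \<in> A"
  shows "\<rho> X \<le> m"
proof -
  have "risk_measure A S X \<le> ereal m"
    unfolding risk_measure_def using assms(2) by (intro Inf_lower) blast
  then show ?thesis using risk_measure_eq[OF assms(1)] by simp
qed

text \<open>The infimum need not be attained, hence the strict inequality. Some acceptable
  \<open>n\<close> lies below \<open>m\<close>, and the larger hedge stays acceptable because the
  payoff \<open>snd S\<close> is nonnegative.\<close>

lemma acceptable_above_\<rho>:
  assumes "X \<in> bounded_measurable M" "\<rho> X < m"
  shows "X + hedge m \<in> A"
proof -
  have "Inf {ereal n | n. X + hedge n \<in> A} < ereal m"
    using assms risk_measure_eq[OF assms(1)] by (simp add: risk_measure_def)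
  then obtain n where "X + hedge n \<in> A" "n < m"
    by (auto simp: Inf_less_iff)
  show ?thesis
  proof (rule acceptance_mono)
    show "X + hedge n \<in> A" by fact
    show "X + hedge n \<le> X + hedge m" using \<open>n < m\<close> by (intro add_left_mono hedge_mono) simp
    show "X + hedge m \<in> bounded_measurable M" using assms(1) hedge_closed by (rule closed_intros)
  qed
qed

lemma \<rho>_antimono:
  assumes "X \<in> bounded_measurable M" "Y \<in> bounded_measurable M" "X \<le> Y"
  shows "\<rho> Y \<le> \<rho> X"
proof (rule dense_ge)
  fix m assume "\<rho> X < m"
  then have "X + hedge m \<in> A" using assms acceptable_above_\<rho> by blast
  then have "Y + hedge m \<in> A"
  proof (rule acceptance_mono)
    show "X + hedge m \<le> Y + hedge m" using assms(3) by (rule add_right_mono)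
    show "Y + hedge m \<in> bounded_measurable M" using assms(2) hedge_closed by (rule closed_intros)
  qed
  then show "\<rho> Y \<le> m" using assms \<rho>_lower by blast
qed

text \<open>\<open>hedge\<close> is linear, so mixing hedges that are optimal up to \<open>e\<close>
  gives a hedge of the mixed position, again with slack \<open>e\<close>.\<close>

lemma \<rho>_convex:
  assumes X: "X \<in> bounded_measurable M" and Y: "Y \<in> bounded_measurable M"
    and t: "0 \<le> t" "t \<le> 1"
  shows "\<rho> ((1 - t) *\<^sub>R X + t *\<^sub>R Y) \<le> (1 - t) * \<rho> X + t * \<rho> Y"
proof (rule field_le_epsilon)
  fix e :: real assume "0 < e"
  then have "(1 - t) *\<^sub>R (X + hedge (\<rho> X + e)) + t *\<^sub>R (Y + hedge (\<rho> Y + e)) \<in> A"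
    using t X Y by (intro convexD_alt[OF convex] acceptable_above_\<rho>) auto
  moreover have "(1 - t) *\<^sub>R (X + hedge (\<rho> X + e)) + t *\<^sub>R (Y + hedge (\<rho> Y + e)) =
      ((1 - t) *\<^sub>R X + t *\<^sub>R Y) + hedge ((1 - t) * \<rho> X + t * \<rho> Y + e)"
    by (simp add: fun_eq_iff add_divide_distrib diff_divide_distrib algebra_simps)
  ultimately show "\<rho> ((1 - t) *\<^sub>R X + t *\<^sub>R Y) \<le> (1 - t) * \<rho> X + t * \<rho> Y + e"
    using X Y by (intro \<rho>_lower closed_intros) auto
qed

lemma \<rho>_scaleR_le:
  assumes "positive_cone A" "X \<in> bounded_measurable M" "0 < c"
  shows "\<rho> (c *\<^sub>R X) \<le> c * \<rho> X"
proof (rule field_le_epsilon)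
  fix e :: real assume "0 < e"
  \<comment> \<open>The slack \<open>e / c\<close> becomes \<open>e\<close> after scaling by
    \<open>c\<close>.\<close>
  then have "X + hedge (\<rho> X + e / c) \<in> A"
    using assms by (intro acceptable_above_\<rho>) auto
  then have "c *\<^sub>R (X + hedge (\<rho> X + e / c)) \<in> A"
    using assms by (auto simp: positive_cone_def)
  moreover have "c *\<^sub>R (X + hedge (\<rho> X + e / c)) = c *\<^sub>R X + hedge (c * \<rho> X + e)"
    using assms(3) by (simp add: fun_eq_iff add_divide_distrib algebra_simps)
  ultimately show "\<rho> (c *\<^sub>R X) \<le> c * \<rho> X + e"
    using assms by (intro \<rho>_lower closed_intros) auto
qed

text \<open>The sum is twice the midpoint: convexity bounds the midpoint and the cone property
  handles the factor 2.\<close>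

lemma \<rho>_subadditive:
  assumes cone: "positive_cone A" and X: "X \<in> bounded_measurable M" and Y: "Y \<in> bounded_measurable M"
  shows "\<rho> (X + Y) \<le> \<rho> X + \<rho> Y"
proof -
  have "X + Y = 2 *\<^sub>R ((1 - 1/2) *\<^sub>R X + (1/2) *\<^sub>R Y)"
    by (simp add: fun_eq_iff)
  moreover have "\<rho> (2 *\<^sub>R ((1 - 1/2) *\<^sub>R X + (1/2) *\<^sub>R Y)) \<le> 2 * \<rho> ((1 - 1/2) *\<^sub>R X + (1/2) *\<^sub>R Y)"
    using X Y by (intro \<rho>_scaleR_le cone closed_intros) auto
  ultimately show ?thesis
    using \<rho>_convex[OF X Y, of "1/2"] by simp
qed

text \<open>Replaces an arbitrary \<open>Y\<close> near \<open>X\<close> by a point on the ray from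
  \<open>X\<close> in the fixed direction \<open>- u\<close>.\<close>

lemma \<rho>_le_diff_indicator:
  assumes X: "X \<in> bounded_measurable M" and Y: "Y \<in> bounded_measurable M"
    and d: "sup_dist M X Y \<le> d"
  shows "\<rho> Y \<le> \<rho> (X - d *\<^sub>R u)"
proof (rule \<rho>_antimono)
  show "X - d *\<^sub>R u \<le> Y"
    using le_add_sup_dist_indicator[OF X Y d] by (simp add: le_fun_def diff_le_eq)
qed (intro closed_intros X Y)+

lemma locally_Lipschitz: "locally_Lipschitz M (risk_measure A S)"
  unfolding locally_Lipschitz_def
proof
  fix X assume X: "X \<in> bounded_measurable M"
  interpret Metric_space "bounded_measurable M" "sup_dist M" by (rule Metric_space_sup_dist)
  \<comment> \<open>If \<open>Y\<close> is within distance 1 of \<open>X\<close>, then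
    \<open>Y - u\<close> lies above \<open>X - 2 *\<^sub>R u\<close> and \<open>Y\<close> below
    \<open>X + u\<close>, so \<open>C\<close> bounds the slope
    \<open>\<rho> (Y - u) - \<rho> Y\<close> independently of \<open>Y\<close>.\<close>
  define C where "C = \<rho> (X - 2 *\<^sub>R u) - \<rho> (X + u)"
  have increment: "\<rho> Z - \<rho> Y \<le> C * sup_dist M Y Z"
    if Y: "Y \<in> mball X (1/2)" and Z: "Z \<in> mball X (1/2)" for Y Z
  proof -
    define d where "d = sup_dist M Y Z"
    have carrier: "Y \<in> bounded_measurable M" "Z \<in> bounded_measurable M"
      and dist: "sup_dist M X Y \<le> 1" "sup_dist M Y X \<le> 1"
      using Y Z commute[of X Y] by auto
    \<comment> \<open>Radius 1/2 makes the diameter at most 1, which puts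
      \<open>Y - d *\<^sub>R u\<close> on the segment from \<open>Y\<close> to
      \<open>Y - u\<close>.\<close>
    have d: "0 \<le> d" "d \<le> 1"
      using Y Z triangle[of Y X Z] commute[of X Y] by (auto simp: d_def)
    have "\<rho> Z \<le> \<rho> (Y - d *\<^sub>R u)"
      using carrier by (intro \<rho>_le_diff_indicator) (auto simp: d_def)
    also have "Y - d *\<^sub>R u = (1 - d) *\<^sub>R Y + d *\<^sub>R (Y - u)"
      by (simp add: fun_eq_iff algebra_simps)
    also have "\<rho> \<dots> \<le> (1 - d) * \<rho> Y + d * \<rho> (Y - u)"
      using carrier d by (intro \<rho>_convex closed_intros)
    finally have "\<rho> Z - \<rho> Y \<le> (\<rho> (Y - u) - \<rho> Y) * d"
      by (simp add: algebra_simps)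
    also have "\<dots> \<le> C * d"
    proof (rule mult_right_mono)
      have "X - 2 *\<^sub>R u \<le> Y - u" "Y \<le> X + u"
        using le_add_sup_dist_indicator[OF X carrier(1) dist(1)]
          le_add_sup_dist_indicator[OF carrier(1) X dist(2)]
        by (auto simp: le_fun_def algebra_simps)
      then have "\<rho> (Y - u) \<le> \<rho> (X - 2 *\<^sub>R u)" "\<rho> (X + u) \<le> \<rho> Y"
        using X carrier by (auto intro!: \<rho>_antimono closed_intros)
      then show "\<rho> (Y - u) - \<rho> Y \<le> C" by (simp add: C_def)
    qed fact
    finally show ?thesis by (simp add: d_def)
  qed
  \<comment> \<open>The one-sided estimate is symmetric in the two points, so swapping them bounds
    the absolute value.\<close>
  have "dist (\<rho> Y) (\<rho> Z) \<le> C * sup_dist M Y Z"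
    if "Y \<in> mball X (1/2)" "Z \<in> mball X (1/2)" for Y Z
    using increment[OF that] increment[OF that(2,1)] commute[of Y Z]
    by (simp add: dist_real_def abs_le_iff)
  then have "Lipschitz_continuous_map (submetric (sup_metric M) (mball_of (sup_metric M) X (1/2)))
      euclidean_metric \<rho>"
    unfolding Lipschitz_continuous_map_def by (intro conjI exI[of _ C]) auto
  then show "\<exists>r>0. Lipschitz_continuous_map
      (submetric (sup_metric M) (mball_of (sup_metric M) X r)) euclidean_metric
      (\<lambda>Y. real_of_ereal (risk_measure A S Y))"
    by (intro exI[of _ "1/2"]) (simp add: \<rho>_def[abs_def])
qed

lemma globally_Lipschitz:
  assumes cone: "positive_cone A"
  shows "globally_Lipschitz M (risk_measure A S)"
proof -
  interpret Metric_space "bounded_measurable M" "sup_dist M" by (rule Metric_space_sup_dist)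
  define C where "C = \<rho> (- 1 *\<^sub>R u)"
  have increment: "\<rho> Y - \<rho> X \<le> C * sup_dist M X Y"
    if X: "X \<in> bounded_measurable M" and Y: "Y \<in> bounded_measurable M" for X Y
  \<comment> \<open>Equal points are split off because \<open>positive_cone\<close> permits scaling
    by \<open>d\<close> only for \<open>d > 0\<close>.\<close>
  proof (cases "X = Y")
    case False
    define d where "d = sup_dist M X Y"
    have "0 < d" using False X Y by (simp add: d_def mdist_pos_less)
    have "\<rho> Y \<le> \<rho> (X - d *\<^sub>R u)"
      using X Y by (intro \<rho>_le_diff_indicator) (auto simp: d_def)
    \<comment> \<open>Written as a sum, the increment no longer depends on \<open>X\<close> and
      scales with \<open>d\<close>, so no restriction to small \<open>d\<close> arises.\<close>
    also have "X - d *\<^sub>R u = X + d *\<^sub>R (- 1 *\<^sub>R u)"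
      by (simp add: fun_eq_iff)
    also have "\<rho> \<dots> \<le> \<rho> X + \<rho> (d *\<^sub>R (- 1 *\<^sub>R u))"
      using X by (intro \<rho>_subadditive cone closed_intros)
    also have "\<rho> (d *\<^sub>R (- 1 *\<^sub>R u)) \<le> d * C"
      unfolding C_def using \<open>0 < d\<close> by (intro \<rho>_scaleR_le cone closed_intros)
    finally show ?thesis by (simp add: d_def mult.commute)
  qed (use Y in simp)
  have "dist (\<rho> X) (\<rho> Y) \<le> C * sup_dist M X Y"
    if "X \<in> bounded_measurable M" "Y \<in> bounded_measurable M" for X Y
    using increment[OF that] increment[OF that(2,1)] commute[of X Y]
    by (simp add: dist_real_def abs_le_iff)
  then have "Lipschitz_continuous_map (sup_metric M) euclidean_metric \<rho>"
    by (auto simp: Lipschitz_continuous_map_def)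
  then show ?thesis by (simp add: globally_Lipschitz_def \<rho>_def[abs_def])
qed

end

theorem theorem4p2:
  fixes M :: "'a measure" and A :: "('a \<Rightarrow> real) set" and S :: "real \<times> ('a \<Rightarrow> real)"
  assumes "acceptance_set M A" and "convex A" and "traded_asset M S"
  shows "(finitely_valued M (risk_measure A S) \<longrightarrow> locally_Lipschitz M (risk_measure A S)) \<and>
    (coherent A \<and> finitely_valued M (risk_measure A S) \<longrightarrow>
      globally_Lipschitz M (risk_measure A S))"
proof (intro conjI impI)
  assume "finitely_valued M (risk_measure A S)"
  then interpret finite_risk_measure M A S using assms by unfold_locales
  show "locally_Lipschitz M (risk_measure A S)" by (rule locally_Lipschitz)
next
  assume *: "coherent A \<and> finitely_valued M (risk_measure A S)"
  then interpret finite_risk_measure M A S using assms by unfold_locales auto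
  show "globally_Lipschitz M (risk_measure A S)"
    using * by (intro globally_Lipschitz) (simp add: coherent_def)
qed

end
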